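(* Let $n\geq 1$. The algebra $\mathfrak{E}^{\{3\}}_{n+1}$ is qualitatively representable if and only if $n\geq 3$ and $n$ is odd. Moreover, up to isomorphism, every qualitative representation of $\mathfrak{E}^{\{3\}}_{n+1}$ is induced by one of the colourings $\lambda_1$ or $\lambda_2$ associated with some commutative idempotent quasigroup $(Q,\cdot)$ on $\{0,\dots,n-1\}$, where $\lambda_1$ is the colouring of the complete graph on $\{0,\dots,n-1\}$ with $\lambda_1(i,i)=1'$ and $\lambda_1(i,j)=c_{i\cdot j}$ for $i\neq j$, and $\lambda_2$ is the colouring of the complete graph on $\{-1,0,\dots,n-1\}$ with $\lambda_2(i,i)=1'$, $\lambda_2(i,j)=\lambda_1(i,j)$ for distinct $i,j\neq-1$, and $\lambda_2(-1,j)=\lambda_2(j,-1)=c_j$ for $j\neq -1$.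
   Context: Let $C=\{c_0,\dots,c_{n-1}\}$ and $C^+=\{1'\}\cup C$. The chromatic algebra $\mathfrak{E}^{\{3\}}_{n+1}$: a triple $(x,y,z)\in (C^+)^3$ is consistent if either one of $x,y,z$ equals $1'$ and the other two are equal, or $x,y,z\in C$ are pairwise distinct. The algebra has universe the power set of $C^+$, set-theoretic Boolean operations ($0=\varnothing$, $1=C^+$), identity $\{1'\}$, converse the identity map, and composition $X;Y=\{z:(x,y,z)\text{ consistent for some }x\in X,y\in Y\}$; $\leq$ is inclusion. A qualitative representation of $\mathbf A$ on a set $U$ is an injective Boolean algebra homomorphism $\varphi$ from $\mathbf A$ into the power set of $U\times U$ with $\varphi(0)=\varnothing$, $\varphi(1)=U\times U$, $\varphi(1')=\mathrm{Id}_U$, $\varphi(\breve x)=\varphi(x)^{\smile}$, and $\varphi(x)\circ\varphi(y)\subseteq\varphi(z)$ iff $x;y\leq z$ for all $x,y,z$ ($\circ$ relational composition). A colouring $\lambda$ of $U\times U$ by $C^+$ induces the map $X\mapsto\bigcup_{a\in X}\lambda^{-1}(a)$. A quasigroup is commutative if $x\cdot y=y\cdot x$ and idempotent if $x\cdot x=x$.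
   Formalization: The equivalence "representable iff n ≥ 3 and n odd" is stated only for n ≠ 1, since for n = 1 it fails: the algebra with one colour is represented on two points; the "moreover" part is kept for all n ≥ 1. *)

theory Defs
  imports "HOL-Library.Infinite_Typeclass"
begin

section \<open>Algebras in the signature of relation algebras and their qualitative representations\<close>

record 'a rel_alg =
  carrier :: "'a set"
  join :: "'a \<Rightarrow> 'a \<Rightarrow> 'a"
  meet :: "'a \<Rightarrow> 'a \<Rightarrow> 'a"
  compl :: "'a \<Rightarrow> 'a"
  zero :: "'a"
  one :: "'a"
  ident :: "'a"
  conv :: "'a \<Rightarrow> 'a"
  comp :: "'a \<Rightarrow> 'a \<Rightarrow> 'a"

definition alg_le :: "('a, 'm) rel_alg_scheme \<Rightarrow> 'a \<Rightarrow> 'a \<Rightarrow> bool" where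
  "alg_le A x y \<longleftrightarrow> join A x y = y"

definition qualitative_representation ::
  "('a, 'm) rel_alg_scheme \<Rightarrow> 'u set \<Rightarrow> ('a \<Rightarrow> 'u rel) \<Rightarrow> bool" where
  "qualitative_representation A U \<phi> \<longleftrightarrow>
     inj_on \<phi> (carrier A) \<and>
     (\<forall>x\<in>carrier A. \<phi> x \<subseteq> U \<times> U) \<and>
     (\<forall>x\<in>carrier A. \<forall>y\<in>carrier A. \<phi> (join A x y) = \<phi> x \<union> \<phi> y) \<and>
     (\<forall>x\<in>carrier A. \<forall>y\<in>carrier A. \<phi> (meet A x y) = \<phi> x \<inter> \<phi> y) \<and>
     (\<forall>x\<in>carrier A. \<phi> (compl A x) = U \<times> U - \<phi> x) \<and>
     \<phi> (zero A) = {} \<and>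
     \<phi> (one A) = U \<times> U \<and>
     \<phi> (ident A) = Id_on U \<and>
     (\<forall>x\<in>carrier A. \<phi> (conv A x) = (\<phi> x)\<inverse>) \<and>
     (\<forall>x\<in>carrier A. \<forall>y\<in>carrier A. \<forall>z\<in>carrier A.
        \<phi> x O \<phi> y \<subseteq> \<phi> z \<longleftrightarrow> alg_le A (comp A x y) z)"

text \<open>The base set cannot be quantified over all types inside a formula, so the type of
  its points is a parameter; it is meant to be instantiated with infinite types only, so that
  it does not bound the size of finite bases.\<close>

definition qualitatively_representable ::
  "'u itself \<Rightarrow> ('a, 'm) rel_alg_scheme \<Rightarrow> bool" where
  "qualitatively_representable T A \<longleftrightarrow>
     (\<exists>(U :: 'u set) \<phi>. qualitative_representation A U \<phi>)"

text \<open>An isomorphism is a bijection of the bases; elements of the algebra are kept fixed.\<close>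

definition isomorphic_representations ::
  "('a, 'm) rel_alg_scheme \<Rightarrow> 'u set \<Rightarrow> ('a \<Rightarrow> 'u rel) \<Rightarrow> 'v set \<Rightarrow> ('a \<Rightarrow> 'v rel) \<Rightarrow> bool" where
  "isomorphic_representations A U \<phi> V \<psi> \<longleftrightarrow>
     (\<exists>f. bij_betw f U V \<and> (\<forall>x\<in>carrier A. \<psi> x = map_prod f f ` \<phi> x))"


section \<open>The chromatic algebra\<close>

text \<open>Colours are indexed by integers so that they share a type with the vertices of the
  complete graphs below, one of which has the vertex \<open>-1\<close>.\<close>

datatype atom = Ident | Col int

definition colours :: "nat \<Rightarrow> atom set" where
  "colours n = Col ` {0..<int n}"

definition colours_plus :: "nat \<Rightarrow> atom set" where
  "colours_plus n = insert Ident (colours n)"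

definition consistent :: "nat \<Rightarrow> atom \<Rightarrow> atom \<Rightarrow> atom \<Rightarrow> bool" where
  "consistent n x y z \<longleftrightarrow>
     x \<in> colours_plus n \<and> y \<in> colours_plus n \<and> z \<in> colours_plus n \<and>
     ((x = Ident \<and> y = z) \<or> (y = Ident \<and> x = z) \<or> (z = Ident \<and> x = y) \<or>
      (x \<in> colours n \<and> y \<in> colours n \<and> z \<in> colours n \<and> x \<noteq> y \<and> y \<noteq> z \<and> x \<noteq> z))"

text \<open>\<open>chromatic3 n\<close> is the algebra with \<open>n\<close> colours, hence \<open>n + 1\<close> atoms.\<close>

definition chromatic3 :: "nat \<Rightarrow> atom set rel_alg" where
  "chromatic3 n =
     \<lparr> carrier = Pow (colours_plus n),
       join = (\<union>),
       meet = (\<inter>),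
       compl = (\<lambda>X. colours_plus n - X),
       zero = {},
       one = colours_plus n,
       ident = {Ident},
       conv = (\<lambda>X. X),
       comp = (\<lambda>X Y. {z. \<exists>x\<in>X. \<exists>y\<in>Y. consistent n x y z}) \<rparr>"


section \<open>Quasigroups and colourings\<close>

definition quasigroup_on :: "'q set \<Rightarrow> ('q \<Rightarrow> 'q \<Rightarrow> 'q) \<Rightarrow> bool" where
  "quasigroup_on Q f \<longleftrightarrow>
     (\<forall>x\<in>Q. \<forall>y\<in>Q. f x y \<in> Q) \<and>
     (\<forall>a\<in>Q. \<forall>b\<in>Q. (\<exists>!x. x \<in> Q \<and> f a x = b) \<and> (\<exists>!y. y \<in> Q \<and> f y a = b))"

definition comm_idem_quasigroup_on :: "'q set \<Rightarrow> ('q \<Rightarrow> 'q \<Rightarrow> 'q) \<Rightarrow> bool" where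
  "comm_idem_quasigroup_on Q f \<longleftrightarrow>
     quasigroup_on Q f \<and> (\<forall>x\<in>Q. \<forall>y\<in>Q. f x y = f y x) \<and> (\<forall>x\<in>Q. f x x = x)"

definition induced_map :: "'u set \<Rightarrow> ('u \<Rightarrow> 'u \<Rightarrow> 'a) \<Rightarrow> 'a set \<Rightarrow> 'u rel" where
  "induced_map U l X = (\<Union>a\<in>X. {(u, v). u \<in> U \<and> v \<in> U \<and> l u v = a})"

definition lambda1 :: "(int \<Rightarrow> int \<Rightarrow> int) \<Rightarrow> int \<Rightarrow> int \<Rightarrow> atom" where
  "lambda1 f i j = (if i = j then Ident else Col (f i j))"

definition lambda2 :: "(int \<Rightarrow> int \<Rightarrow> int) \<Rightarrow> int \<Rightarrow> int \<Rightarrow> atom" where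
  "lambda2 f i j =
     (if i = j then Ident
      else if i = -1 then Col j
      else if j = -1 then Col i
      else lambda1 f i j)"


section \<open>One colour\<close>

text \<open>The algebra with a single colour is the complex algebra of the group of order two, and
  it is represented on any two-element set.  So \<open>n = 1\<close>, although it is odd and not
  \<open>\<ge> 3\<close>, is an exception to the characterisation of the representable algebras.\<close>

lemma chromatic3_one_colour:
  fixes a b :: "'u"
  assumes "a \<noteq> b"
  shows "qualitative_representation (chromatic3 1) {a, b}
           (induced_map {a, b} (\<lambda>u v. if u = v then Ident else Col 0))"
proof -
  define l :: "'u \<Rightarrow> 'u \<Rightarrow> atom" where "l = (\<lambda>u v. if u = v then Ident else Col 0)"
  define \<phi> where "\<phi> = induced_map {a, b} l"
  define K where "K = {Ident, Col 0}"
  have C: "colours 1 = {Col 0}" "colours_plus 1 = K"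
    by (auto simp: colours_def colours_plus_def K_def)
  have mem: "(u, v) \<in> \<phi> X \<longleftrightarrow> u \<in> {a, b} \<and> v \<in> {a, b} \<and> l u v \<in> X" for u v X
    by (auto simp: \<phi>_def induced_map_def)
  have lK: "l u v \<in> K" for u v
    by (auto simp: l_def K_def)
  have le: "\<phi> X \<subseteq> \<phi> Z \<longleftrightarrow> X \<subseteq> Z" if "X \<subseteq> K" for X Z
  proof
    assume *: "\<phi> X \<subseteq> \<phi> Z"
    have "Ident \<in> X \<Longrightarrow> Ident \<in> Z" using subsetD[OF *, of "(a, a)"] by (simp add: mem l_def)
    moreover have "Col 0 \<in> X \<Longrightarrow> Col 0 \<in> Z"
      using subsetD[OF *, of "(a, b)"] assms by (simp add: mem l_def)
    ultimately show "X \<subseteq> Z" using that by (auto simp: K_def)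
  qed (auto simp: \<phi>_def induced_map_def)
  define cmp where "cmp = (\<lambda>X Y. {z. \<exists>x\<in>X. \<exists>y\<in>Y. consistent 1 x y z})"
  have cmpK: "cmp X Y \<subseteq> K" for X Y
    by (auto simp: cmp_def consistent_def C simp del: One_nat_def)
  have cons: "consistent 1 x y z \<longleftrightarrow>
      x \<in> K \<and> y \<in> K \<and> z = (if x = y then Ident else Col 0)" for x y z
    by (auto simp: consistent_def C K_def simp del: One_nat_def)
  have comp: "\<phi> X O \<phi> Y = \<phi> (cmp X Y)" if X: "X \<subseteq> K" and Y: "Y \<subseteq> K" for X Y
  proof (intro subset_antisym subrelI)
    fix u w assume "(u, w) \<in> \<phi> X O \<phi> Y"
    then obtain v where v: "(u, v) \<in> \<phi> X" "(v, w) \<in> \<phi> Y" by blast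
    have "consistent 1 (l u v) (l v w) (l u w)"
      using v lK unfolding cons mem l_def by auto
    then show "(u, w) \<in> \<phi> (cmp X Y)"
      using v unfolding mem cmp_def by blast
  next
    fix u w assume "(u, w) \<in> \<phi> (cmp X Y)"
    then obtain x y where xy: "x \<in> X" "y \<in> Y" "consistent 1 x y (l u w)"
      and uw: "u \<in> {a, b}" "w \<in> {a, b}"
      unfolding mem cmp_def by blast
    obtain v where v: "v \<in> {a, b}" "l u v = x"
    proof (cases "x = Ident")
      case True
      then show ?thesis using that[of u] uw by (simp add: l_def)
    next
      case False
      then have "x = Col 0" using xy X by (auto simp: K_def)
      then show ?thesis using that[of a] that[of b] uw assms by (auto simp: l_def)
    qed
    have "l v w = y"
      using xy(3) v uw unfolding cons by (auto simp: l_def K_def split: if_splits)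
    then show "(u, w) \<in> \<phi> X O \<phi> Y"
      using v uw xy by (intro relcompI[of u v]) (auto simp: mem)
  qed
  have A: "chromatic3 1 = \<lparr> carrier = Pow K, join = (\<union>), meet = (\<inter>), compl = (\<lambda>X. K - X),
      zero = {}, one = K, ident = {Ident}, conv = (\<lambda>X. X), comp = cmp \<rparr>"
    by (simp add: chromatic3_def C cmp_def del: One_nat_def)
  have inj: "inj_on \<phi> (Pow K)"
    by (intro inj_onI subset_antisym) (use le in \<open>blast+\<close>)
  have sub: "\<phi> X \<subseteq> {a, b} \<times> {a, b}" for X
    using mem by auto
  have jm: "\<phi> (X \<union> Y) = \<phi> X \<union> \<phi> Y" "\<phi> (X \<inter> Y) = \<phi> X \<inter> \<phi> Y" for X Y
    by (rule set_eqI; clarsimp simp: mem; blast)+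
  have cp: "\<phi> (K - X) = {a, b} \<times> {a, b} - \<phi> X" for X
    by (rule set_eqI) (auto simp: mem lK)
  have zo: "\<phi> {} = {}" "\<phi> K = {a, b} \<times> {a, b}"
    by (rule set_eqI; clarsimp simp: mem lK; blast?)+
  have idt: "\<phi> {Ident} = Id_on {a, b}"
    using assms by (auto simp: mem l_def)
  have cv: "(\<phi> X)\<inverse> = \<phi> X" for X
    by (rule set_eqI) (auto simp: mem l_def split: if_splits)
  have cm: "\<phi> X O \<phi> Y \<subseteq> \<phi> Z \<longleftrightarrow> cmp X Y \<union> Z = Z" if "X \<subseteq> K" "Y \<subseteq> K" for X Y Z
    using comp[OF that] le[OF cmpK] by (simp add: subset_Un_eq)
  have "qualitative_representation (chromatic3 1) {a, b} \<phi>"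
    unfolding qualitative_representation_def alg_le_def A rel_alg.simps
    by (intro conjI ballI inj sub jm cp zo idt cv[symmetric] cm) (simp_all only: Pow_iff)
  then show ?thesis
    unfolding \<phi>_def l_def .
qed

end

theory Submission
  imports Defs
begin

text \<open>A qualitative representation amounts to an edge colouring of a complete graph in which the
  three edges of every triangle have distinct colours and every three distinct colours occur on
  some triangle. The colouring is proper, so the graph has at most \<open>n + 1\<close> vertices. If
  there are \<open>m\<close> vertices and \<open>k\<close> ordered edges of a colour \<open>c\<close>, counting the triangles
  through \<open>c\<close> gives \<open>(n - 1) * (n - 2) \<le> k * (m - 2)\<close>, and \<open>k \<le> m\<close>; so, for \<open>n \<ge> 3\<close>, \<open>m \<ge> n\<close>, and
  \<open>m = n\<close> forces \<open>k \<ge> n - 1\<close>. If \<open>m = n\<close>, every vertex misses exactly one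
  colour and different vertices miss different colours; naming a vertex after the colour it misses
  gives \<open>\<lambda>\<^sub>1\<close>. If \<open>m = n + 1\<close>, every vertex sees every colour, and naming the other vertices after
  the colour joining them to a fixed one gives \<open>\<lambda>\<^sub>2\<close>. Since \<open>k\<close> is even, \<open>n\<close> is odd in both cases.
  Conversely, for odd \<open>n\<close> the colouring \<open>i + j\<close> modulo \<open>n\<close> works, because 2 is invertible.\<close>

section \<open>Representations as colourings\<close>

lemma card_colours [simp]: "finite (colours n)" "card (colours n) = n"
  by (simp_all add: colours_def card_image inj_on_def)

lemma Ident_notin_colours [simp]: "Ident \<notin> colours n"
  by (auto simp: colours_def)

lemma card_colours_plus [simp]: "finite (colours_plus n)" "card (colours_plus n) = Suc n"
  by (simp_all add: colours_plus_def)

lemma consistent_Ident [simp]: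
  "consistent n x y Ident \<longleftrightarrow> x \<in> colours_plus n \<and> y = x"
  by (auto simp: consistent_def colours_plus_def)

lemma consistent_colours:
  assumes "consistent n x y z" "x \<noteq> Ident" "y \<noteq> Ident" "z \<noteq> Ident"
  shows "x \<noteq> y" "y \<noteq> z" "x \<noteq> z"
  using assms by (auto simp: consistent_def)

lemma consistent_colours_iff:
  assumes "x \<in> colours n" "y \<in> colours n" "z \<in> colours n"
  shows "consistent n x y z \<longleftrightarrow> x \<noteq> y \<and> y \<noteq> z \<and> x \<noteq> z"
  using assms by (auto simp: consistent_def colours_plus_def colours_def)

lemma mem_induced_map:
  "(u, v) \<in> induced_map U l X \<longleftrightarrow> u \<in> U \<and> v \<in> U \<and> l u v \<in> X"
  by (auto simp: induced_map_def)

text \<open>The last two assumptions are the two directions of the composition condition, read on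
  atoms. \<open>l_realises\<close> asks for one triangle of each consistent type, not for one over
  every edge of the right colour; this is what makes the representation only qualitative.\<close>

locale chromatic_colouring =
  fixes n :: nat and U :: "'u set" and l :: "'u \<Rightarrow> 'u \<Rightarrow> atom"
  assumes l_in: "\<lbrakk>u \<in> U; v \<in> U\<rbrakk> \<Longrightarrow> l u v \<in> colours_plus n"
    and l_Ident_iff: "\<lbrakk>u \<in> U; v \<in> U\<rbrakk> \<Longrightarrow> l u v = Ident \<longleftrightarrow> u = v"
    and l_sym: "\<lbrakk>u \<in> U; v \<in> U\<rbrakk> \<Longrightarrow> l u v = l v u"
    and l_consistent: "\<lbrakk>u \<in> U; v \<in> U; w \<in> U\<rbrakk> \<Longrightarrow> consistent n (l u v) (l v w) (l u w)"
    and l_realises: "consistent n x y z \<Longrightarrow>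
      \<exists>u\<in>U. \<exists>v\<in>U. \<exists>w\<in>U. l u v = x \<and> l v w = y \<and> l u w = z"

text \<open>The algebra is finite and Boolean, so the images of its atoms partition
  \<open>U \<times> U\<close>. The colour of a pair is the atom whose image contains it.\<close>

lemma representation_is_colouring:
  assumes "qualitative_representation (chromatic3 n) U \<phi>"
  obtains l where "chromatic_colouring n U l"
    and "\<And>X. X \<subseteq> colours_plus n \<Longrightarrow> \<phi> X = induced_map U l X"
proof -
  let ?P = "colours_plus n"
  define cmp where "cmp = (\<lambda>X Y. {z. \<exists>x\<in>X. \<exists>y\<in>Y. consistent n x y z})"
  have un: "\<phi> (X \<union> Y) = \<phi> X \<union> \<phi> Y" and int: "\<phi> (X \<inter> Y) = \<phi> X \<inter> \<phi> Y"
    and cv: "\<phi> X = (\<phi> X)\<inverse>" if "X \<subseteq> ?P" "Y \<subseteq> ?P" for X Y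
    using assms that by (auto simp: qualitative_representation_def chromatic3_def)
  have zero: "\<phi> {} = {}" and one: "\<phi> ?P = U \<times> U" and idt: "\<phi> {Ident} = Id_on U"
    using assms by (auto simp: qualitative_representation_def chromatic3_def)
  have cm: "\<phi> X O \<phi> Y \<subseteq> \<phi> Z \<longleftrightarrow> cmp X Y \<subseteq> Z" if "X \<subseteq> ?P" "Y \<subseteq> ?P" "Z \<subseteq> ?P" for X Y Z
    using assms that
    by (simp add: qualitative_representation_def chromatic3_def alg_le_def cmp_def subset_Un_eq)
  have atoms: "\<phi> X = (\<Union>a\<in>X. \<phi> {a})" if "X \<subseteq> ?P" for X
  proof -
    have "finite X" using that card_colours_plus(1) finite_subset by blast
    then show ?thesis using that
    proof induction
      case (insert a X)
      then show ?case using un[of "{a}" X] by simp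
    qed (simp add: zero)
  qed
  have ex: "\<exists>a. a \<in> ?P \<and> (u, v) \<in> \<phi> {a}" if "u \<in> U" "v \<in> U" for u v
    using one atoms[of ?P] that by auto
  have uniq: "a = b" if "p \<in> \<phi> {a}" "p \<in> \<phi> {b}" "a \<in> ?P" "b \<in> ?P" for a b p
  proof (rule ccontr)
    assume "a \<noteq> b"
    then have "\<phi> {a} \<inter> \<phi> {b} = {}" using int[of "{a}" "{b}"] that zero by simp
    then show False using that by blast
  qed
  define l where "l u v = (SOME a. a \<in> ?P \<and> (u, v) \<in> \<phi> {a})" for u v
  have l: "l u v \<in> ?P" "(u, v) \<in> \<phi> {l u v}" if "u \<in> U" "v \<in> U" for u v
    using someI_ex[OF ex[OF that]] by (auto simp: l_def)
  have sub: "\<phi> {a} \<subseteq> U \<times> U" if "a \<in> ?P" for a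
    using one atoms[of ?P] that by auto
  have memI: "(u, v) \<in> \<phi> {a} \<longleftrightarrow> u \<in> U \<and> v \<in> U \<and> l u v = a" if "a \<in> ?P" for u v a
    using l uniq sub that by blast
  have mem: "(u, v) \<in> \<phi> X \<longleftrightarrow> u \<in> U \<and> v \<in> U \<and> l u v \<in> X" if "X \<subseteq> ?P" for u v X
  proof -
    have "(u, v) \<in> \<phi> X \<longleftrightarrow> (\<exists>a\<in>X. (u, v) \<in> \<phi> {a})"
      by (subst atoms[OF that]) (rule UN_iff)
    also have "\<dots> \<longleftrightarrow> (\<exists>a\<in>X. u \<in> U \<and> v \<in> U \<and> l u v = a)"
      using that by (intro bex_cong refl memI) auto
    finally show ?thesis by blast
  qed
  have IdP: "Ident \<in> ?P" by (simp add: colours_plus_def)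
  have "chromatic_colouring n U l"
  proof
    fix u v assume uv: "u \<in> U" "v \<in> U"
    show "l u v \<in> ?P" using l uv by blast
    show "l u v = Ident \<longleftrightarrow> u = v"
      using memI[OF IdP, of u v] uv idt by auto
    show "l u v = l v u"
      using memI[OF l(1)[OF uv]] uv cv[of "{l u v}" "{}"] l(1)[OF uv]
      by (metis converse_iff empty_subsetI insert_subset)
  next
    fix u v w assume uvw: "u \<in> U" "v \<in> U" "w \<in> U"
    have sub: "{l u v} \<subseteq> ?P" "{l v w} \<subseteq> ?P" "cmp {l u v} {l v w} \<subseteq> ?P"
      using l uvw by (auto simp: cmp_def consistent_def)
    \<comment> \<open>The composite is taken as its own upper bound.\<close>
    have "(u, w) \<in> \<phi> (cmp {l u v} {l v w})"
      using cm[OF sub] l uvw by blast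
    then show "consistent n (l u v) (l v w) (l u w)"
      using mem[OF sub(3)] by (simp add: cmp_def)
  next
    fix x y z assume c: "consistent n x y z"
    then have P: "{x} \<subseteq> ?P" "{y} \<subseteq> ?P" "?P - {z} \<subseteq> ?P" by (auto simp: consistent_def)
    \<comment> \<open>Testing against the complement of the atom \<open>z\<close>: the failing
      inclusion yields a path coloured \<open>x\<close>, \<open>y\<close> whose closing pair lies
      outside the image of that complement, hence has colour \<open>z\<close>.\<close>
    have "\<not> cmp {x} {y} \<subseteq> ?P - {z}" using c by (auto simp: cmp_def)
    then obtain u v w where uvw: "(u, v) \<in> \<phi> {x}" "(v, w) \<in> \<phi> {y}" "(u, w) \<notin> \<phi> (?P - {z})"
      using cm[OF P] by blast
    then have "u \<in> U" "v \<in> U" "w \<in> U" "l u v = x" "l v w = y"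
      using mem[OF P(1)] mem[OF P(2)] by auto
    moreover from this have "l u w = z"
      using uvw(3) mem[OF P(3)] l(1) by auto
    ultimately show "\<exists>u\<in>U. \<exists>v\<in>U. \<exists>w\<in>U. l u v = x \<and> l v w = y \<and> l u w = z"
      by blast
  qed
  moreover have "\<phi> X = induced_map U l X" if "X \<subseteq> ?P" for X
    using mem[OF that] by (auto simp: mem_induced_map)
  ultimately show thesis using that by blast
qed

section \<open>From colourings back to representations\<close>

context chromatic_colouring
begin

lemma colouring_is_representation:
  "qualitative_representation (chromatic3 n) U (induced_map U l)"
proof -
  let ?P = "colours_plus n" and ?\<phi> = "induced_map U l"
  define cmp where "cmp = (\<lambda>X Y. {z. \<exists>x\<in>X. \<exists>y\<in>Y. consistent n x y z})"
  \<comment> \<open>Every atom occurs because the triple \<open>a\<close>, \<open>a\<close>,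
    \<open>Ident\<close> is consistent. Injectivity of the induced map rests on this.\<close>
  have ex: "\<exists>u\<in>U. \<exists>v\<in>U. l u v = a" if "a \<in> ?P" for a
    using l_realises[of a a Ident] that by auto
  have le: "X \<subseteq> Y" if "X \<subseteq> ?P" "?\<phi> X \<subseteq> ?\<phi> Y" for X Y
  proof
    fix a assume a: "a \<in> X"
    then obtain u v where "u \<in> U" "v \<in> U" "l u v = a" using ex \<open>X \<subseteq> ?P\<close> by blast
    moreover from this have "(u, v) \<in> ?\<phi> Y"
      using a by (intro subsetD[OF \<open>?\<phi> X \<subseteq> ?\<phi> Y\<close>]) (simp add: mem_induced_map)
    ultimately show "a \<in> Y" by (simp add: mem_induced_map)
  qed
  have cm: "?\<phi> X O ?\<phi> Y \<subseteq> ?\<phi> Z \<longleftrightarrow> cmp X Y \<union> Z = Z"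
    if "X \<subseteq> ?P" "Y \<subseteq> ?P" for X Y Z
  proof
    assume *: "?\<phi> X O ?\<phi> Y \<subseteq> ?\<phi> Z"
    have "z \<in> Z" if "x \<in> X" "y \<in> Y" "consistent n x y z" for x y z
    proof -
      obtain u v w where "u \<in> U" "v \<in> U" "w \<in> U" "l u v = x" "l v w = y" "l u w = z"
        using l_realises[OF \<open>consistent n x y z\<close>] by blast
      then have "(u, v) \<in> ?\<phi> X" "(v, w) \<in> ?\<phi> Y" "l u w = z"
        using that by (auto simp: mem_induced_map)
      moreover from this have "(u, w) \<in> ?\<phi> Z" using * by blast
      ultimately show ?thesis by (simp add: mem_induced_map)
    qed
    then show "cmp X Y \<union> Z = Z" by (auto simp: cmp_def)
  next
    assume "cmp X Y \<union> Z = Z"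
    then show "?\<phi> X O ?\<phi> Y \<subseteq> ?\<phi> Z"
      using l_consistent by (fastforce simp: mem_induced_map cmp_def)
  qed
  have A: "chromatic3 n = \<lparr> carrier = Pow ?P, join = (\<union>), meet = (\<inter>), compl = (\<lambda>X. ?P - X),
      zero = {}, one = ?P, ident = {Ident}, conv = (\<lambda>X. X), comp = cmp \<rparr>"
    by (simp add: chromatic3_def cmp_def)
  have inj: "inj_on ?\<phi> (Pow ?P)"
  proof (rule inj_onI)
    fix X Y assume "X \<in> Pow ?P" "Y \<in> Pow ?P" "?\<phi> X = ?\<phi> Y"
    then show "X = Y" using le[of X Y] le[of Y X] by simp
  qed
  have "?\<phi> X \<subseteq> U \<times> U" "?\<phi> (X \<union> Y) = ?\<phi> X \<union> ?\<phi> Y" "?\<phi> (X \<inter> Y) = ?\<phi> X \<inter> ?\<phi> Y"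
    "?\<phi> {} = {}" for X Y
    by (auto simp: mem_induced_map)
  moreover have "?\<phi> (?P - X) = U \<times> U - ?\<phi> X" "?\<phi> ?P = U \<times> U" "?\<phi> {Ident} = Id_on U" for X
    using l_in l_Ident_iff by (auto simp: mem_induced_map)
  moreover have "?\<phi> X = (?\<phi> X)\<inverse>" for X
    by (rule set_eqI) (clarsimp simp: mem_induced_map, metis l_sym)
  ultimately show ?thesis
    unfolding qualitative_representation_def alg_le_def A rel_alg.simps
    using inj cm by simp
qed

text \<open>Reduces isomorphism of representations to a relabelling of the vertices that preserves
  colours.\<close>

lemma isomorphic_induced:
  assumes h: "bij_betw h U V" and l': "\<And>u v. \<lbrakk>u \<in> U; v \<in> U\<rbrakk> \<Longrightarrow> l' (h u) (h v) = l u v"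
    and \<phi>: "\<And>X. X \<subseteq> colours_plus n \<Longrightarrow> \<phi> X = induced_map U l X"
  shows "isomorphic_representations (chromatic3 n) U \<phi> V (induced_map V l')"
proof -
  have "induced_map V l' X = map_prod h h ` induced_map U l X" for X
    using l' bij_betw_imp_surj_on[OF h] by (force simp: induced_map_def)
  then show ?thesis
    using h \<phi> by (auto simp: isomorphic_representations_def chromatic3_def)
qed

section \<open>Counting edges and triangles\<close>

lemma l_colour: "\<lbrakk>u \<in> U; v \<in> U; u \<noteq> v\<rbrakk> \<Longrightarrow> l u v \<in> colours n"
  using l_in l_Ident_iff by (auto simp: colours_plus_def)

text \<open>If \<open>v\<close> and \<open>w\<close> differed, they would form with \<open>u\<close>
  a triangle with two sides of the same colour. The statement covers loops too, as pairs of colour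
  \<open>Ident\<close>.\<close>

lemma l_proper:
  assumes "u \<in> U" "v \<in> U" "w \<in> U" "l u v = l u w" shows "v = w"
proof (rule ccontr)
  assume "v \<noteq> w"
  moreover have "u \<noteq> v" "u \<noteq> w"
    using assms \<open>v \<noteq> w\<close> l_Ident_iff by metis+
  ultimately have "l v u \<noteq> l u w"
    using consistent_colours(1)[OF l_consistent[of v u w]] assms(1-3) l_Ident_iff by auto
  then show False using assms l_sym by simp
qed

lemma l_inj: "u \<in> U \<Longrightarrow> inj_on (l u) U"
  using l_proper by (auto intro: inj_onI)

lemma U_nonempty: "U \<noteq> {}"
  using l_realises[of Ident Ident Ident] by (auto simp: colours_plus_def)

text \<open>For any vertex \<open>u\<close>, properness makes \<open>l u\<close> an embedding of
  \<open>U\<close> into the \<open>n + 1\<close> atoms.\<close>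

lemma finite_U: "finite U" and card_U_le: "card U \<le> Suc n"
proof -
  obtain u where u: "u \<in> U" using U_nonempty by blast
  have sub: "l u ` U \<subseteq> colours_plus n" using l_in u by blast
  show "finite U"
    using inj_on_finite[OF l_inj[OF u] sub] by simp
  show "card U \<le> Suc n"
    using card_inj_on_le[OF l_inj[OF u] sub] by simp
qed

definition edges :: "atom \<Rightarrow> 'u rel" where
  "edges c = {(u, v). u \<in> U \<and> v \<in> U \<and> l u v = c}"

lemma finite_edges: "finite (edges c)"
  by (rule finite_subset[of _ "U \<times> U"]) (auto simp: edges_def finite_U)

text \<open>By properness at most one edge of colour \<open>c\<close> starts at each vertex, so
  counting ordered edges amounts to counting the vertices that see \<open>c\<close>.\<close>

lemma card_Domain_edges: "card (Domain (edges c)) = card (edges c)"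
proof -
  have "inj_on fst (edges c)"
    using l_proper by (auto simp: inj_on_def edges_def)
  then show ?thesis by (simp add: Domain_fst card_image)
qed

lemma Domain_edges_subset: "Domain (edges c) \<subseteq> U"
  by (auto simp: edges_def)

lemma Domain_edges:
  assumes "c \<in> colours n"
  shows "u \<in> Domain (edges c) \<longleftrightarrow> u \<in> U \<and> c \<in> l u ` (U - {u})"
proof -
  have "v \<noteq> u" if "u \<in> U" "l u v = c" for v
    using that assms l_Ident_iff[of u u] by auto
  then show ?thesis unfolding edges_def by blast
qed

lemma edge_exists:
  assumes "c \<in> colours n"
  obtains u v where "u \<in> U" "v \<in> U" "u \<noteq> v" "l u v = c"
proof -
  have "consistent n c c Ident" using assms by (simp add: colours_plus_def)
  then obtain u v where "u \<in> U" "v \<in> U" "l u v = c" using l_realises by metis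
  moreover have "c \<noteq> Ident" using assms by auto
  ultimately show thesis using that l_Ident_iff by metis
qed

end

text \<open>Swapping coordinates is an involution of \<open>E\<close> without fixed points, so its
  orbits split \<open>E\<close> into pairs.\<close>

lemma even_card_sym_irrefl:
  assumes "finite E" "sym E" "irrefl E" shows "even (card E)"
proof -
  define C where "C = (\<lambda>e. {e, prod.swap e}) ` E"
  have "\<Union>C = E" using \<open>sym E\<close> by (auto simp: C_def dest: symD)
  moreover have "card c = 2" if c: "c \<in> C" for c
  proof -
    obtain u v where "(u, v) \<in> E" "c = {(u, v), (v, u)}" using c by (auto simp: C_def)
    moreover have "u \<noteq> v" using \<open>irrefl E\<close> calculation by (auto simp: irrefl_def)
    ultimately show ?thesis by simp
  qed
  moreover have "c \<inter> d = {}" if "c \<in> C" "d \<in> C" "c \<noteq> d" for c d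
    using that by (auto simp: C_def)
  ultimately have "2 * card C = card E"
    using card_partition[of C 2] \<open>finite E\<close> by (simp add: C_def)
  then show ?thesis by (metis dvd_triv_left)
qed

section \<open>Parity and triangle counts of a colour class\<close>

context chromatic_colouring
begin

lemma even_edges:
  assumes "c \<in> colours n" shows "even (card (edges c))"
proof (rule even_card_sym_irrefl[OF finite_edges])
  show "sym (edges c)" using l_sym by (auto simp: edges_def intro: symI)
  have "c \<noteq> Ident" using assms by auto
  then show "irrefl (edges c)" using l_Ident_iff by (auto simp: edges_def irrefl_def)
qed

text \<open>\<open>D\<close> holds the ordered pairs of distinct colours other than
  \<open>c\<close>, and \<open>T\<close> the ordered \<open>c\<close>-edges with a third vertex.
  Every pair in \<open>D\<close> must colour the other two sides of some member of \<open>T\<close>,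
  so \<open>D\<close> is no larger than \<open>T\<close>.\<close>

lemma triangle_bound:
  assumes c: "c \<in> colours n"
  shows "(n - 1) * (n - 2) \<le> card (edges c) * (card U - 2)"
proof -
  define D where "D = Sigma (colours n - {c}) (\<lambda>d. colours n - {c, d})"
  define T where "T = Sigma (edges c) (\<lambda>(u, v). U - {u, v})"
  have "card (colours n - {c, d}) = n - 2" if "d \<in> colours n - {c}" for d
    using c that by (subst card_Diff_subset) auto
  then have "card D = (\<Sum>d\<in>colours n - {c}. n - 2)"
    unfolding D_def by (subst card_SigmaI) auto
  then have D: "card D = (n - 1) * (n - 2)" using c by simp
  have "card (U - {u, v}) = card U - 2" if "(u, v) \<in> edges c" for u v
  proof -
    have "u \<noteq> v" using that c l_Ident_iff[of u v] by (auto simp: edges_def)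
    then show ?thesis using that finite_U by (auto simp: edges_def card_Diff_subset)
  qed
  then have "(\<Sum>e\<in>edges c. card (case e of (u, v) \<Rightarrow> U - {u, v})) = (\<Sum>e\<in>edges c. card U - 2)"
    by (intro sum.cong) auto
  then have T: "card T = card (edges c) * (card U - 2)"
    unfolding T_def using finite_edges finite_U by (subst card_SigmaI) (auto split: prod.splits)
  have "finite T"
    unfolding T_def using finite_edges finite_U by (auto intro!: finite_SigmaI)
  moreover have "D \<subseteq> (\<lambda>((u, v), w). (l u w, l v w)) ` T"
  proof
    fix p assume "p \<in> D"
    then obtain d e where p: "p = (d, e)" "d \<in> colours n" "e \<in> colours n" "d \<noteq> c" "e \<noteq> c" "d \<noteq> e"
      by (auto simp: D_def)
    \<comment> \<open>The closing side from \<open>u\<close> to \<open>w\<close> comes last, so it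
      receives \<open>d\<close>, the first component of \<open>p\<close>.\<close>
    then have "consistent n c e d" using c by (simp add: consistent_colours_iff)
    then obtain u v w where *: "u \<in> U" "v \<in> U" "w \<in> U" "l u v = c" "l v w = e" "l u w = d"
      using l_realises by metis
    then have "w \<noteq> u" "w \<noteq> v"
      using l_Ident_iff[of v w] l_Ident_iff[of u w] p by auto
    then have "((u, v), w) \<in> T" using * by (auto simp: T_def edges_def)
    then show "p \<in> (\<lambda>((u, v), w). (l u w, l v w)) ` T" using * p by force
  qed
  ultimately have "card D \<le> card T" by (rule surj_card_le)
  then show ?thesis using D T by simp
qed

section \<open>Possible numbers of vertices\<close>

lemma card_edges_le: "card (edges c) \<le> card U"
  using card_mono[OF finite_U Domain_edges_subset] card_Domain_edges by metis

lemma card_U_ge: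
  assumes "n \<ge> 3" shows "card U \<ge> n"
proof (rule ccontr)
  assume less: "\<not> n \<le> card U"
  have "Col 0 \<in> colours n" using assms by (auto simp: colours_def)
  then have "(n - 1) * (n - 2) \<le> card (edges (Col 0)) * (card U - 2)" by (rule triangle_bound)
  \<comment> \<open>Fewer than \<open>n\<close> vertices bound the two factors by
    \<open>n - 1\<close> and \<open>n - 3\<close>, which is too small.\<close>
  also have "\<dots> \<le> (n - 1) * (n - 3)"
    using card_edges_le[of "Col 0"] less by (intro mult_mono) auto
  finally show False using assms by simp
qed

text \<open>With \<open>n\<close> vertices the positive factor \<open>n - 2\<close> stands on both
  sides of the triangle bound and cancels.\<close>

lemma card_edges_ge:
  assumes "n \<ge> 3" "card U = n" "c \<in> colours n" shows "card (edges c) \<ge> n - 1"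
  using triangle_bound[OF assms(3)] assms(1,2) by simp

text \<open>A triangle needs three colours, so with at most two there are only two vertices. Their
  single edge then carries the only colour.\<close>

lemma few_colours:
  assumes "n \<ge> 1" "n \<le> 2" shows "n = 1 \<and> card U = 2"
proof -
  have "Col 0 \<in> colours n" using assms by (auto simp: colours_def)
  then obtain u v where uv: "u \<in> U" "v \<in> U" "u \<noteq> v" "l u v = Col 0" by (rule edge_exists)
  have U: "U = {u, v}"
  proof (rule ccontr)
    assume "U \<noteq> {u, v}"
    then obtain w where w: "w \<in> U" "w \<noteq> u" "w \<noteq> v" using uv by blast
    have "{l u v, l v w, l u w} \<subseteq> colours n" using l_colour uv(1-3) w by blast
    from card_mono[OF _ this] have "card {l u v, l v w, l u w} \<le> 2" using assms by simp
    moreover have "l u v \<noteq> l v w \<and> l v w \<noteq> l u w \<and> l u v \<noteq> l u w"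
      using consistent_colours[OF l_consistent[of u v w]] l_Ident_iff uv w by auto
    ultimately show False by simp
  qed
  have "n = 1"
  proof (rule ccontr)
    assume "n \<noteq> 1"
    then have "Col 1 \<in> colours n" using assms by (auto simp: colours_def)
    then obtain x y where "x \<in> U" "y \<in> U" "x \<noteq> y" "l x y = Col 1" by (rule edge_exists)
    then show False using U uv l_sym by auto
  qed
  then show ?thesis using U uv by simp
qed

text \<open>The one-colour algebra has a base of two points and so falls under the first
  alternative.\<close>

lemma card_U_cases:
  assumes "n \<ge> 1"
  shows "card U = Suc n \<or> card U = n \<and> n \<ge> 3"
  using few_colours[OF assms] card_U_ge card_U_le by linarith

section \<open>Colours seen and missed at a vertex\<close>

lemma sees_all_colours:
  assumes "card U = Suc n" "u \<in> U" shows "l u ` U = colours_plus n"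
  using assms l_in l_inj[of u] by (intro card_subset_eq) (auto simp: card_image)

text \<open>The description is determinate when \<open>card U = n\<close>: the \<open>n - 1\<close>
  edges at \<open>u\<close> then have distinct colours, leaving exactly one out.\<close>

definition missed :: "'u \<Rightarrow> int" where
  "missed u = (THE i. Col i \<in> colours n - l u ` (U - {u}))"

lemma missed:
  assumes "card U = n" "u \<in> U"
  shows "colours n - l u ` (U - {u}) = {Col (missed u)}"
proof -
  have sub: "l u ` (U - {u}) \<subseteq> colours n" using l_colour assms by auto
  have "card (l u ` (U - {u})) = n - 1"
    using assms l_inj[of u] finite_U by (subst card_image) (auto simp: inj_on_diff)
  moreover have "n \<ge> 1" using assms finite_U by (metis One_nat_def Suc_leI card_gt_0_iff empty_iff)
  ultimately have "card (colours n - l u ` (U - {u})) = 1"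
    using sub finite_U by (subst card_Diff_subset) auto
  then obtain x where x: "colours n - l u ` (U - {u}) = {x}" by (rule card_1_singletonE)
  moreover have "x \<in> colours n" using x by blast
  then obtain i where "x = Col i" by (auto simp: colours_def)
  ultimately show ?thesis by (simp add: missed_def)
qed

text \<open>A colour missed by two vertices would be seen by at most \<open>n - 2\<close>, against
  the lower bound \<open>n - 1\<close> for its class. Injectivity suffices because both sets have
  \<open>n\<close> elements.\<close>

lemma bij_missed:
  assumes n: "n \<ge> 3" and U: "card U = n"
  shows "bij_betw missed U {0..<int n}"
proof -
  have "u = v" if uv: "u \<in> U" "v \<in> U" "missed u = missed v" for u v
  proof (rule ccontr)
    assume "u \<noteq> v"
    let ?c = "Col (missed u)"
    have c: "?c \<in> colours n" "?c \<notin> l u ` (U - {u})" "?c \<notin> l v ` (U - {v})"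
      using missed[OF U uv(1)] missed[OF U uv(2)] uv(3) by auto
    have "x \<in> U - {u, v}" if "x \<in> Domain (edges ?c)" for x
      using Domain_edges[OF c(1)] c(2,3) that by auto
    then have "Domain (edges ?c) \<subseteq> U - {u, v}" by blast
    then have "card (edges ?c) \<le> card (U - {u, v})"
      using card_mono finite_U by (metis card_Domain_edges finite_Diff)
    also have "\<dots> = n - 2" using uv \<open>u \<noteq> v\<close> finite_U U by (simp add: card_Diff_subset)
    finally show False using card_edges_ge[OF n U c(1)] n by simp
  qed
  then have inj: "inj_on missed U" by (rule inj_onI)
  moreover have "missed ` U \<subseteq> {0..<int n}"
    using missed[OF U] by (fastforce simp: colours_def)
  then have "missed ` U = {0..<int n}"
    using U inj by (intro card_subset_eq) (auto simp: card_image)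
  ultimately show ?thesis by (simp add: bij_betw_def)
qed

text \<open>The vertices that see colour \<open>0\<close> are even in number. There are
  \<open>n + 1\<close> of them in the larger case and \<open>n - 1\<close> in the smaller.\<close>

lemma odd_n:
  assumes "n \<ge> 1" shows "odd n"
proof -
  have c: "Col 0 \<in> colours n" using assms by (auto simp: colours_def)
  note ev = even_edges[OF c]
  show ?thesis using card_U_cases[OF assms]
  proof
    assume U: "card U = Suc n"
    have "Domain (edges (Col 0)) = U"
    proof
      show "U \<subseteq> Domain (edges (Col 0))"
      proof
        fix u assume u: "u \<in> U"
        have "Col 0 \<in> l u ` U" using sees_all_colours[OF U u] c by (simp add: colours_plus_def)
        then show "u \<in> Domain (edges (Col 0))" using u by (auto simp: edges_def)
      qed
    qed (rule Domain_edges_subset)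
    then show ?thesis using ev card_Domain_edges U by (metis even_Suc)
  next
    assume U: "card U = n \<and> n \<ge> 3"
    \<comment> \<open>Some vertex misses colour \<open>0\<close>, so its class has fewer than
      \<open>n\<close> ordered edges; the lower bound then fixes the number at
      \<open>n - 1\<close>.\<close>
    have "0 \<in> missed ` U" using bij_missed U by (auto simp: bij_betw_def)
    then obtain u where u: "u \<in> U" "missed u = 0" by auto
    have "Col 0 \<notin> l u ` (U - {u})" using missed[of u] U u by auto
    then have "u \<notin> Domain (edges (Col 0))" by (simp add: Domain_edges[OF c])
    then have "card (edges (Col 0)) < n"
      using psubset_card_mono[OF finite_U, of "Domain (edges (Col 0))"] Domain_edges_subset u U
        card_Domain_edges by fastforce
    then have "card (edges (Col 0)) = n - 1" using card_edges_ge[OF _ _ c] U by simp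
    then show ?thesis using ev U by simp
  qed
qed

section \<open>The quasigroup of a colouring\<close>

text \<open>Common core of both cases: the product of two labels is the colour of the edge between
  their vertices, and the diagonal is filled in idempotently. \<open>avoid\<close> keeps the
  diagonal entry from recurring in its row, and properness separates the other entries.\<close>

lemma quasigroup_of_labelling:
  assumes WU: "W \<subseteq> U" and h: "bij_betw h W {0..<int n}"
    and avoid: "\<And>u v. \<lbrakk>u \<in> W; v \<in> W; u \<noteq> v\<rbrakk> \<Longrightarrow> l u v \<noteq> Col (h u)"
  obtains f where "comm_idem_quasigroup_on {0..<int n} f"
    and "\<And>u v. \<lbrakk>u \<in> W; v \<in> W\<rbrakk> \<Longrightarrow> lambda1 f (h u) (h v) = l u v"
proof -
  let ?Q = "{0..<int n}"
  define g where "g = inv_into W h"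
  \<comment> \<open>\<open>THE\<close> merely strips the constructor \<open>Col\<close>, which is
    legitimate for distinct labels in \<open>?Q\<close>.\<close>
  define f where "f i j = (if i = j then i else THE k. Col k = l (g i) (g j))" for i j
  have g: "g i \<in> W" "h (g i) = i" if "i \<in> ?Q" for i
    using that bij_betw_imp_surj_on[OF h] unfolding g_def
    by (simp_all only: inv_into_into f_inv_into_f)
  have hQ: "h u \<in> ?Q" and gh: "g (h u) = u" if "u \<in> W" for u
    using bij_betwE[OF h] bij_betw_inv_into_left[OF h] that unfolding g_def by blast+
  have gU: "g i \<in> U" if "i \<in> ?Q" for i using g(1)[OF that] WU by blast
  have Colf: "Col (f i j) = l (g i) (g j)" "f i j \<in> ?Q" if ij: "i \<in> ?Q" "j \<in> ?Q" "i \<noteq> j" for i j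
  proof -
    have "g i \<noteq> g j" using g ij by metis
    then have "l (g i) (g j) \<in> colours n" using l_colour gU ij by simp
    then obtain k where "l (g i) (g j) = Col k" "k \<in> ?Q" by (auto simp: colours_def)
    then show "Col (f i j) = l (g i) (g j)" "f i j \<in> ?Q" using ij by (auto simp: f_def)
  qed
  have idem: "f i i = i" for i by (simp add: f_def)
  have comm: "f i j = f j i" if "i \<in> ?Q" "j \<in> ?Q" for i j
    using that l_sym gU by (simp add: f_def)
  have fQ: "f i j \<in> ?Q" if "i \<in> ?Q" "j \<in> ?Q" for i j
    using Colf idem that by (cases "i = j") auto
  have ne: "f i j \<noteq> i" if "i \<in> ?Q" "j \<in> ?Q" "i \<noteq> j" for i j
    using Colf(1)[OF that] avoid[of "g i" "g j"] g that by metis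
  have inj: "j = k" if ijk: "i \<in> ?Q" "j \<in> ?Q" "k \<in> ?Q" and eq: "f i j = f i k" for i j k
  proof (cases "j = i \<or> k = i")
    case True
    then show ?thesis using ne idem ijk eq by metis
  next
    case False
    then have "l (g i) (g j) = l (g i) (g k)" using Colf ijk eq by metis
    then show ?thesis using l_proper gU g ijk by metis
  qed
  have ex: "\<exists>!j. j \<in> ?Q \<and> f i j = b" if "i \<in> ?Q" "b \<in> ?Q" for i b
  proof -
    have "f i ` ?Q \<subseteq> ?Q" using fQ[OF that(1)] by blast
    moreover have "inj_on (f i) ?Q" using inj[OF that(1)] by (rule inj_onI)
    ultimately have "f i ` ?Q = ?Q" by (intro endo_inj_surj) auto
    then obtain j where "j \<in> ?Q" "f i j = b" using \<open>b \<in> ?Q\<close> by (metis imageE)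
    then show ?thesis using inj[OF that(1)] by (intro ex1I[of _ j]) auto
  qed
  have ex': "\<exists>!j. j \<in> ?Q \<and> f j i = b" if "i \<in> ?Q" "b \<in> ?Q" for i b
    using ex[OF that] comm that by metis
  have "comm_idem_quasigroup_on ?Q f"
    unfolding comm_idem_quasigroup_on_def quasigroup_on_def
    by (intro conjI ballI fQ ex ex' comm idem)
  moreover have "lambda1 f (h u) (h v) = l u v" if uv: "u \<in> W" "v \<in> W" for u v
  proof (cases "u = v")
    case True
    then show ?thesis using uv WU l_Ident_iff[of v v] by (auto simp: lambda1_def)
  next
    case False
    then have "h u \<noteq> h v" using gh uv by metis
    then show ?thesis using Colf(1)[of "h u" "h v"] hQ gh uv by (simp add: lambda1_def)
  qed
  ultimately show thesis using that by blast
qed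

text \<open>Labelling each vertex by the colour it misses satisfies the avoidance condition at
  once.\<close>

lemma lambda1_labelling:
  assumes n: "n \<ge> 3" and U: "card U = n"
  obtains f h where "comm_idem_quasigroup_on {0..<int n} f" "bij_betw h U {0..<int n}"
    and "\<And>u v. \<lbrakk>u \<in> U; v \<in> U\<rbrakk> \<Longrightarrow> lambda1 f (h u) (h v) = l u v"
proof -
  note h = bij_missed[OF assms]
  have "l u v \<noteq> Col (missed u)" if "u \<in> U" "v \<in> U" "u \<noteq> v" for u v
    using missed[OF U that(1)] that by blast
  then obtain f where "comm_idem_quasigroup_on {0..<int n} f"
      "\<And>u v. \<lbrakk>u \<in> U; v \<in> U\<rbrakk> \<Longrightarrow> lambda1 f (missed u) (missed v) = l u v"
    using quasigroup_of_labelling[OF order_refl h] by metis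
  then show thesis using that h by blast
qed

text \<open>A chosen vertex \<open>z\<close> becomes \<open>-1\<close>, and any other vertex is
  labelled by the colour of its edge to \<open>z\<close>. Properness at that vertex keeps this
  colour off its remaining edges, so the other \<open>n\<close> vertices carry a quasigroup.\<close>

lemma lambda2_labelling:
  assumes U: "card U = Suc n"
  obtains f h where "comm_idem_quasigroup_on {0..<int n} f" "bij_betw h U {-1..<int n}"
    and "\<And>u v. \<lbrakk>u \<in> U; v \<in> U\<rbrakk> \<Longrightarrow> lambda2 f (h u) (h v) = l u v"
proof -
  obtain z where z: "z \<in> U" using U_nonempty by blast
  define W where "W = U - {z}"
  define h where "h u = (if u = z then -1 else THE i. Col i = l z u)" for u
  have hz: "h z = -1" by (simp add: h_def)
  have h: "Col (h u) = l z u" "h u \<in> {0..<int n}" if "u \<in> W" for u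
  proof -
    have "l z u \<in> colours n" using l_colour z that by (auto simp: W_def)
    then obtain i where "l z u = Col i" "i \<in> {0..<int n}" by (auto simp: colours_def)
    then show "Col (h u) = l z u" "h u \<in> {0..<int n}" using that by (auto simp: h_def W_def)
  qed
  have inj: "inj_on h W"
    using h(1) l_proper z by (intro inj_onI) (metis DiffD1 W_def)
  have "card W = n" using U z finite_U by (simp add: W_def)
  then have "h ` W = {0..<int n}"
    using inj h(2) by (intro card_subset_eq) (auto simp: card_image)
  then have bW: "bij_betw h W {0..<int n}" using inj by (simp add: bij_betw_def)
  have "l u v \<noteq> Col (h u)" if "u \<in> W" "v \<in> W" "u \<noteq> v" for u v
    using h(1)[OF that(1)] l_sym l_proper z that by (metis DiffD1 DiffD2 W_def singletonI)
  then obtain f where f: "comm_idem_quasigroup_on {0..<int n} f"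
      "\<And>u v. \<lbrakk>u \<in> W; v \<in> W\<rbrakk> \<Longrightarrow> lambda1 f (h u) (h v) = l u v"
    using quasigroup_of_labelling[OF _ bW] by (metis Diff_subset W_def)
  have "bij_betw h (insert z W) (insert (-1) {0..<int n})"
    using notIn_Un_bij_betw[of z W h "{0..<int n}"] bW hz by (simp add: W_def)
  moreover have "insert z W = U" "insert (-1) {0..<int n} = {-1..<int n}"
    using z by (auto simp: W_def)
  ultimately have "bij_betw h U {-1..<int n}" by simp
  moreover have "lambda2 f (h u) (h v) = l u v" if uv: "u \<in> U" "v \<in> U" for u v
  proof -
    have eq: "h u = h v \<longleftrightarrow> u = v"
      using bij_betw_imp_inj_on[OF calculation] uv by (auto dest: inj_onD)
    consider "u = v" | "u = z" "v \<in> W" | "v = z" "u \<in> W" | "u \<in> W" "v \<in> W" "u \<noteq> v"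
      using uv by (auto simp: W_def)
    then show ?thesis
    proof cases
      case 1
      then show ?thesis using uv l_Ident_iff[of v v] by (simp add: lambda2_def)
    next
      case 2
      then show ?thesis using h[of v] hz by (auto simp: lambda2_def)
    next
      case 3
      then show ?thesis using h[of u] hz l_sym[of z u] z uv by (auto simp: lambda2_def)
    next
      case 4
      then show ?thesis using h(2)[of u] h(2)[of v] f(2)[of u v] eq by (auto simp: lambda2_def)
    qed
  qed
  ultimately show thesis using that f by blast
qed

end

section \<open>Representations for odd numbers of colours\<close>

text \<open>Addition in the cyclic group of order \<open>n\<close>. For odd \<open>n\<close>,
  renaming each vertex \<open>i\<close> as \<open>2 * i\<close> modulo \<open>n\<close>, the colour
  it misses, would give a \<open>lambda1\<close> colouring.\<close>

definition cyclic_colour :: "nat \<Rightarrow> int \<Rightarrow> int \<Rightarrow> atom" where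
  "cyclic_colour n i j = (if i = j then Ident else Col ((i + j) mod int n))"

lemma chromatic_colouring_cyclic:
  assumes n: "n \<ge> 3" "odd n"
  shows "chromatic_colouring n {0..<int n} (cyclic_colour n)"
proof
  let ?Q = "{0..<int n}" and ?l = "cyclic_colour n"
  \<comment> \<open>\<open>h\<close> is the inverse of 2 modulo \<open>n\<close>.\<close>
  obtain h :: int where h: "int n + 1 = 2 * h"
  proof -
    have "even (int n + 1)" using n(2) by simp
    then show ?thesis using that by (elim evenE)
  qed
  have cancel: "j = k" if "(i + j) mod int n = (i + k) mod int n" "j \<in> ?Q" "k \<in> ?Q" for i j k
  proof -
    have "int n dvd j - k" using that(1) by (simp add: mod_eq_dvd_iff)
    then have "j mod int n = k mod int n" by (simp add: mod_eq_dvd_iff)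
    then show ?thesis using that by simp
  qed
  show in_plus: "?l u v \<in> colours_plus n" for u v
    using n by (auto simp: cyclic_colour_def colours_plus_def colours_def)
  show "?l u v = Ident \<longleftrightarrow> u = v" for u v by (auto simp: cyclic_colour_def)
  show "?l u v = ?l v u" for u v by (auto simp: cyclic_colour_def add.commute)
  show "consistent n (?l u v) (?l v w) (?l u w)" if "u \<in> ?Q" "v \<in> ?Q" "w \<in> ?Q" for u v w
  proof (cases "u = v \<or> v = w \<or> u = w")
    case True
    then show ?thesis using in_plus[of u v] in_plus[of v w] in_plus[of u w]
      by (auto simp: consistent_def cyclic_colour_def add.commute)
  next
    case False
    then show ?thesis
      using n that cancel[of u v w] cancel[of v u w] cancel[of w u v]
      by (subst consistent_colours_iff)
        (auto simp: cyclic_colour_def colours_def add.commute)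
  qed
  have fin: "\<exists>u\<in>?Q. \<exists>v\<in>?Q. \<exists>w\<in>?Q. ?l u v = Col a \<and> ?l v w = Col b \<and> ?l u w = Col c"
    if abc: "a \<in> ?Q" "b \<in> ?Q" "c \<in> ?Q" "a \<noteq> b" "b \<noteq> c" "a \<noteq> c" for a b c
  proof -
    \<comment> \<open>The solution of \<open>u + v = a\<close>, \<open>v + w = b\<close>,
      \<open>u + w = c\<close> modulo \<open>n\<close>, obtained by halving alternating
      sums.\<close>
    define u v w where "u = (h * (a + c - b)) mod int n" and "v = (h * (a + b - c)) mod int n"
      and "w = (h * (b + c - a)) mod int n"
    have half: "(h * x + h * y) mod int n = a" if "x + y = 2 * a" "a \<in> ?Q" for x y a
    proof -
      have "h * x + h * y = h * (2 * a)" by (simp only: flip: that(1) distrib_left)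
      also have "\<dots> = (int n + 1) * a" unfolding h by simp
      also have "\<dots> = a + int n * a" by (simp add: distrib_right)
      finally show ?thesis using that by simp
    qed
    have s: "(u + v) mod int n = a" "(v + w) mod int n = b" "(u + w) mod int n = c"
      unfolding u_def v_def w_def mod_add_eq using abc by (intro half; simp)+
    \<comment> \<open>Two equal vertices would make two of the three sums equal.\<close>
    then have "u \<noteq> v" "v \<noteq> w" "u \<noteq> w" using abc by (auto simp: add.commute)
    moreover have "u \<in> ?Q" "v \<in> ?Q" "w \<in> ?Q" using n by (auto simp: u_def v_def w_def)
    ultimately show ?thesis using s by (metis cyclic_colour_def)
  qed
  have two: "\<exists>u\<in>?Q. \<exists>v\<in>?Q. ?l u v = x" if x: "x \<in> colours_plus n" for x
  proof (cases "x = Ident")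
    case True
    then show ?thesis using n by (force simp: cyclic_colour_def)
  next
    case False
    then obtain a where a: "x = Col a" "a \<in> ?Q"
      using x by (auto simp: colours_plus_def colours_def)
    \<comment> \<open>Two further colours, available since \<open>n \<ge> 3\<close>, so that
      \<open>fin\<close> supplies a triangle with a side of colour \<open>a\<close>.\<close>
    define b c where "b = (if a = 0 then 1 else 0 :: int)" and "c = (if a \<le> 1 then 2 else 1 :: int)"
    have "b \<in> ?Q" "c \<in> ?Q" "a \<noteq> b" "b \<noteq> c" "a \<noteq> c"
      using n a(2) by (auto simp: b_def c_def)
    then show ?thesis using fin[of a b c] a by blast
  qed
  fix x y z assume c: "consistent n x y z"
  show "\<exists>u\<in>?Q. \<exists>v\<in>?Q. \<exists>w\<in>?Q. ?l u v = x \<and> ?l v w = y \<and> ?l u w = z"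
  proof (cases "x = Ident \<or> y = Ident \<or> z = Ident")
    case True
    have Id: "?l u u = Ident" for u by (simp add: cyclic_colour_def)
    have sym: "?l u v = ?l v u" for u v by (auto simp: cyclic_colour_def add.commute)
    have P: "x \<in> colours_plus n" "y \<in> colours_plus n" "z \<in> colours_plus n"
      using c by (auto simp: consistent_def)
    \<comment> \<open>Such a triple is realised by a degenerate triangle: a pair of the common
      colour with one endpoint repeated.\<close>
    consider "x = Ident" "y = z" | "y = Ident" "x = z" | "z = Ident" "x = y"
      using True c by (auto simp: consistent_def)
    then show ?thesis
    proof cases
      case 1 then show ?thesis using two[OF P(2)] Id by metis
    next
      case 2 then show ?thesis using two[OF P(1)] Id by metis
    next
      case 3 then show ?thesis using two[OF P(1)] Id sym by metis
    qed
  next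
    case False
    then have "x \<in> colours n" "y \<in> colours n" "z \<in> colours n"
      using c by (auto simp: consistent_def colours_plus_def)
    then obtain a b d where "x = Col a" "y = Col b" "z = Col d" "a \<in> ?Q" "b \<in> ?Q" "d \<in> ?Q"
      unfolding colours_def by (elim imageE)
    moreover have "x \<noteq> y" "y \<noteq> z" "x \<noteq> z" using False consistent_colours[OF c] by auto
    ultimately show ?thesis using fin[of a b d] by simp
  qed
qed

text \<open>Carries the integer-based cyclic colouring to a base in any type that has enough
  points.\<close>

lemma chromatic_colouring_transport:
  assumes "chromatic_colouring n V l" and h: "bij_betw h U V"
  shows "chromatic_colouring n U (\<lambda>u v. l (h u) (h v))"
proof -
  interpret chromatic_colouring n V l by fact
  have hV: "h u \<in> V" if "u \<in> U" for u using h that by (auto simp: bij_betw_def)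
  have eq: "h u = h v \<longleftrightarrow> u = v" if "u \<in> U" "v \<in> U" for u v
    using bij_betw_imp_inj_on[OF h] that by (auto dest: inj_onD)
  show ?thesis
  proof
    fix x y z assume "consistent n x y z"
    then have "\<exists>u\<in>h ` U. \<exists>v\<in>h ` U. \<exists>w\<in>h ` U. l u v = x \<and> l v w = y \<and> l u w = z"
      using l_realises bij_betw_imp_surj_on[OF h] by simp
    then show "\<exists>u\<in>U. \<exists>v\<in>U. \<exists>w\<in>U. l (h u) (h v) = x \<and> l (h v) (h w) = y \<and> l (h u) (h w) = z"
      by blast
  qed (auto simp: hV eq l_in l_Ident_iff l_consistent intro: l_sym)
qed

lemma representable_if_odd:
  assumes "n \<ge> 3" "odd n"
  shows "qualitatively_representable TYPE('u :: infinite) (chromatic3 n)"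
proof -
  obtain U :: "'u set" where U: "finite U" "card U = n"
    using infinite_arbitrarily_large[OF infinite_UNIV] by blast
  then obtain h where "bij_betw h U {0..<int n}"
    using finite_same_card_bij[of U "{0..<int n}"] by auto
  from chromatic_colouring_transport[OF chromatic_colouring_cyclic[OF assms] this]
  show ?thesis
    using chromatic_colouring.colouring_is_representation
    unfolding qualitatively_representable_def by blast
qed

text \<open>The equivalence excludes \<open>n = 1\<close> because
  \<open>chromatic3_one_colour\<close> represents that algebra. The classification includes it,
  through \<open>lambda2\<close> on the vertices \<open>-1\<close> and \<open>0\<close>.\<close>

theorem theorem10:
  fixes n :: nat
  assumes "n \<ge> 1"
  shows
    "(n \<noteq> 1 \<longrightarrow>
        (qualitatively_representable TYPE('u :: infinite) (chromatic3 n) \<longleftrightarrow> n \<ge> 3 \<and> odd n)) \<and>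
     (\<forall>(U :: 'v set) \<phi>. qualitative_representation (chromatic3 n) U \<phi> \<longrightarrow>
        (\<exists>f. comm_idem_quasigroup_on {0..<int n} f \<and>
           (isomorphic_representations (chromatic3 n) U \<phi>
              {0..<int n} (induced_map {0..<int n} (lambda1 f)) \<or>
            isomorphic_representations (chromatic3 n) U \<phi>
              {-1..<int n} (induced_map {-1..<int n} (lambda2 f)))))"
proof (intro conjI impI allI iffI)
  assume "qualitatively_representable TYPE('u :: infinite) (chromatic3 n)"
  then obtain U :: "'u set" and \<phi> where "qualitative_representation (chromatic3 n) U \<phi>"
    unfolding qualitatively_representable_def by blast
  then obtain l where "chromatic_colouring n U l" by (rule representation_is_colouring)
  then interpret chromatic_colouring n U l .
  show "odd n" using odd_n assms .
  moreover assume "n \<noteq> 1"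
  ultimately show "n \<ge> 3" using assms few_colours by linarith
next
  assume "n \<ge> 3 \<and> odd n"
  then show "qualitatively_representable TYPE('u :: infinite) (chromatic3 n)"
    using representable_if_odd by blast
next
  fix U :: "'v set" and \<phi>
  assume "qualitative_representation (chromatic3 n) U \<phi>"
  then obtain l where "chromatic_colouring n U l"
    and \<phi>: "\<And>X. X \<subseteq> colours_plus n \<Longrightarrow> \<phi> X = induced_map U l X"
    by (rule representation_is_colouring) blast
  then interpret chromatic_colouring n U l by simp
  show "\<exists>f. comm_idem_quasigroup_on {0..<int n} f \<and>
           (isomorphic_representations (chromatic3 n) U \<phi>
              {0..<int n} (induced_map {0..<int n} (lambda1 f)) \<or>
            isomorphic_representations (chromatic3 n) U \<phi>
              {-1..<int n} (induced_map {-1..<int n} (lambda2 f)))"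
    using card_U_cases[OF assms]
  proof
    assume "card U = Suc n"
    then obtain f h where "comm_idem_quasigroup_on {0..<int n} f" "bij_betw h U {-1..<int n}"
        "\<And>u v. \<lbrakk>u \<in> U; v \<in> U\<rbrakk> \<Longrightarrow> lambda2 f (h u) (h v) = l u v"
      using lambda2_labelling by metis
    then show ?thesis using isomorphic_induced \<phi> by blast
  next
    assume "card U = n \<and> n \<ge> 3"
    then obtain f h where "comm_idem_quasigroup_on {0..<int n} f" "bij_betw h U {0..<int n}"
        "\<And>u v. \<lbrakk>u \<in> U; v \<in> U\<rbrakk> \<Longrightarrow> lambda1 f (h u) (h v) = l u v"
      using lambda1_labelling by metis
    then show ?thesis using isomorphic_induced \<phi> by blast
  qed
qed

end
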